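(* For any strict partition $\lambda$, the sequence $(Q_\lambda(1^n))_{n\ge0}$ is log-concave, i.e. $Q_\lambda(1^n)^2\ge Q_\lambda(1^{n-1})\,Q_\lambda(1^{n+1})$ for all $n\ge1$.
   Context: An integer partition $\lambda=(\lambda_1,\ldots,\lambda_k)$ is strict if $\lambda_1>\lambda_2>\cdots>\lambda_k$. Its shifted Young diagram is obtained from the ordinary (left-justified, first row on top) Young diagram by shifting the $i$th row $i-1$ boxes to the right for each $i$. Writing $\bar m=-m$, order the nonzero integers by $\bar1\triangleleft1\triangleleft\bar2\triangleleft2\triangleleft\bar3\triangleleft3\triangleleft\cdots$. A semistandard Young tableau of shifted shape $\lambda$ is a filling $T$ of the cells $(i,j)$ of the shifted diagram of $\lambda$ with nonzero integers $T_{i,j}$ such that: (T1) rows (left-to-right) and columns (top-to-bottom) are weakly increasing with respect to $\trianglelefteq$; (T2) for each $m>0$ there is at most one $\bar m$ in each row and at most one $m$ in each column. The Schur $Q$-function is $Q_\lambda(x_1,x_2,\ldots)=\sum_T\prod_{(i,j)}x_{|T_{i,j}|}$, summed over all semistandard Young tableaux $T$ of shifted shape $\lambda$, the product being over the cells of the shifted diagram. $Q_\lambda(1^n)$ is its value under $x_i=1$ for $i\le n$ and $x_i=0$ for $i>n$. *)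

theory Defs
  imports "HOL-Analysis.Infinite_Sum" "HOL-Library.FuncSet"
begin

definition strict_partition :: "nat list \<Rightarrow> bool" where
  "strict_partition lam \<longleftrightarrow> sorted_wrt (>) lam \<and> (\<forall>p \<in> set lam. p > 0)"

text \<open>Rows and columns are numbered from 0: row \<open>i\<close> is shifted \<open>i\<close> boxes to the right.\<close>

definition shifted_diagram :: "nat list \<Rightarrow> (nat \<times> nat) set" where
  "shifted_diagram lam = {(i, j). i < length lam \<and> i \<le> j \<and> j < i + lam ! i}"

text \<open>
  The barred letter of absolute value \<open>m\<close> is the integer \<open>- m\<close>, so that on nonzero integers
  the order below is \<open>-1, 1, -2, 2, -3, 3, \<dots>\<close>.
\<close>

definition marked_le :: "int \<Rightarrow> int \<Rightarrow> bool" where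
  "marked_le a b \<longleftrightarrow> \<bar>a\<bar> < \<bar>b\<bar> \<or> (\<bar>a\<bar> = \<bar>b\<bar> \<and> a \<le> b)"

text \<open>
  A filling is an extensional function on the diagram (\<open>undefined\<close> off it), so that distinct
  functions are distinct fillings.
\<close>

definition shifted_ssyt :: "nat list \<Rightarrow> (nat \<times> nat \<Rightarrow> int) set" where
  "shifted_ssyt lam = {T \<in> shifted_diagram lam \<rightarrow>\<^sub>E - {0}.
     (\<forall>i j j'. (i, j) \<in> shifted_diagram lam \<and> (i, j') \<in> shifted_diagram lam \<and> j \<le> j'
        \<longrightarrow> marked_le (T (i, j)) (T (i, j'))) \<and>
     (\<forall>i i' j. (i, j) \<in> shifted_diagram lam \<and> (i', j) \<in> shifted_diagram lam \<and> i \<le> i'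
        \<longrightarrow> marked_le (T (i, j)) (T (i', j))) \<and>
     (\<forall>m>0. (\<forall>i. \<exists>\<^sub>\<le>\<^sub>1 j. (i, j) \<in> shifted_diagram lam \<and> T (i, j) = - m) \<and>
            (\<forall>j. \<exists>\<^sub>\<le>\<^sub>1 i. (i, j) \<in> shifted_diagram lam \<and> T (i, j) = m))}"

text \<open>
  The variables are \<open>x 1, x 2, \<dots>\<close>; the value \<open>x 0\<close> never occurs. If only finitely many
  variables are nonzero, all but finitely many summands vanish and the infinite sum is a
  finite one.
\<close>

definition schurQ :: "nat list \<Rightarrow> (nat \<Rightarrow> real) \<Rightarrow> real" where
  "schurQ lam x = (\<Sum>\<^sub>\<infinity>T \<in> shifted_ssyt lam. \<Prod>c \<in> shifted_diagram lam. x (nat \<bar>T c\<bar>))"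

definition ones :: "nat \<Rightarrow> nat \<Rightarrow> real" where
  "ones n i = (if 1 \<le> i \<and> i \<le> n then 1 else 0)"

end

theory Submission
  imports Defs
begin

text \<open>
  Only finitely many tableaux contribute to \<open>Q\<^sub>\<lambda>(1\<^sup>n)\<close>, each with weight 1, so \<open>Q\<^sub>\<lambda>(1\<^sup>n)\<close> counts the
  tableaux whose entries have absolute value in \<open>{1..n}\<close>. Raising all absolute values by one shows
  that it also counts the tableaux with absolute values in \<open>{2..n+1}\<close>.

  The tableaux of a fixed shape form a distributive lattice under the cellwise minimum and maximum
  for the order \<open>-1, 1, -2, 2, \<dots>\<close>: the tableau conditions compare two cells at a time, and each
  comparison survives taking minima and maxima. Take \<open>T\<close> with absolute values in \<open>{1..n+1}\<close> and \<open>S\<close>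
  with absolute values in \<open>{2..n}\<close>. There are \<open>Q\<^sub>\<lambda>(1\<^bsup>n+1\<^esup>)\<close> choices for \<open>T\<close> and \<open>Q\<^sub>\<lambda>(1\<^bsup>n-1\<^esup>)\<close>
  choices for \<open>S\<close>. Their minimum has absolute values in \<open>{1..n}\<close> and their maximum in
  \<open>{2..n+1}\<close>, so there are at most \<open>Q\<^sub>\<lambda>(1\<^sup>n)\<close> minima and at most \<open>Q\<^sub>\<lambda>(1\<^sup>n)\<close> maxima. A pair cannot in
  general be recovered from its minimum and maximum, but in a distributive lattice Daykin's inequality
  \<open>|A| |B| \<le> |A \<or> B| |A \<and> B|\<close> holds nevertheless, and log-concavity follows.

  Daykin's inequality is the case of indicator functions of the four functions theorem of Ahlswede and
  Daykin (lemma \<open>four_functions\<close>). It is proved for families of subsets of a finite set and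
  transferred to tableaux by representing a tableau as the set of all pairs of a cell and a letter
  that is at most the entry of that cell; minimum and maximum become intersection and union.
\<close>

section \<open>The four functions theorem\<close>

text \<open>
  This is the four functions theorem for the subsets of a one-point set. The two mixed products
  \<open>u = a0 * b1\<close> and \<open>v = a1 * b0\<close> are both bounded by \<open>p = c1 * d0\<close>, which alone is not enough,
  but their product is at most \<open>p * (c0 * d1)\<close>; then \<open>(p - u) * (p - v) \<ge> 0\<close> gives
  \<open>u + v \<le> p + c0 * d1\<close>.
\<close>

lemma four_functions_one_point:
  fixes a0 a1 b0 b1 c0 c1 d0 d1 :: real
  assumes nonneg: "0 \<le> a0" "0 \<le> a1" "0 \<le> b0" "0 \<le> b1" "0 \<le> c0" "0 \<le> c1" "0 \<le> d0" "0 \<le> d1"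
    and le: "a0 * b0 \<le> c0 * d0" "a0 * b1 \<le> c1 * d0" "a1 * b0 \<le> c1 * d0" "a1 * b1 \<le> c1 * d1"
  shows "(a0 + a1) * (b0 + b1) \<le> (c0 + c1) * (d0 + d1)"
proof -
  define p u v where "p = c1 * d0" and "u = a0 * b1" and "v = a1 * b0"
  have uv_le: "u * v \<le> p * (c0 * d1)"
  proof -
    have "(a0 * b0) * (a1 * b1) \<le> (c0 * d0) * (c1 * d1)"
      using nonneg le by (intro mult_mono[OF le(1) le(4)]) auto
    then show ?thesis by (simp add: p_def u_def v_def mult_ac)
  qed
  have "u + v \<le> p + c0 * d1"
  proof (cases "p = 0")
    case True
    have "0 \<le> c0 * d1" using nonneg by simp
    with True show ?thesis using le(2,3) unfolding p_def u_def v_def by linarith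
  next
    case False
    then have "p > 0" using nonneg by (simp add: p_def less_le)
    have "0 \<le> (p - u) * (p - v)"
      using le by (intro mult_nonneg_nonneg) (auto simp: p_def u_def v_def)
    then have "p * (u + v) \<le> p * (p + c0 * d1)"
      using uv_le by (simp add: algebra_simps)
    with \<open>p > 0\<close> show ?thesis by simp
  qed
  then show ?thesis
    using le by (simp add: p_def u_def v_def algebra_simps)
qed

lemma sum_Pow_insert:
  fixes f :: "'a set \<Rightarrow> real"
  assumes "finite U" "x \<notin> U"
  shows "sum f (Pow (insert x U)) = (\<Sum>X\<in>Pow U. f X + f (insert x X))"
proof -
  have "inj_on (insert x) (Pow U)" using assms(2) by (auto simp: inj_on_def)
  moreover have "Pow U \<inter> insert x ` Pow U = {}" using assms(2) by auto
  ultimately show ?thesis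
    using assms(1) by (simp add: Pow_insert sum.union_disjoint sum.reindex sum.distrib)
qed

text \<open>
  The induction removes one point \<open>x\<close> of the ground set: each function is replaced by its sum over
  the two choices for \<open>x\<close>, and the one-point case shows that the hypothesis passes to these sums.
\<close>

theorem four_functions:
  fixes a b c d :: "'a set \<Rightarrow> real"
  assumes "finite U"
    and "\<And>X. 0 \<le> a X" "\<And>X. 0 \<le> b X" "\<And>X. 0 \<le> c X" "\<And>X. 0 \<le> d X"
    and "\<And>X Y. X \<subseteq> U \<Longrightarrow> Y \<subseteq> U \<Longrightarrow> a X * b Y \<le> c (X \<union> Y) * d (X \<inter> Y)"
  shows "sum a (Pow U) * sum b (Pow U) \<le> sum c (Pow U) * sum d (Pow U)"
  using assms
proof (induction U arbitrary: a b c d rule: finite_induct)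
  case empty
  then show ?case using empty.prems(5)[of "{}" "{}"] by simp
next
  case (insert x U)
  have "(a X + a (insert x X)) * (b Y + b (insert x Y))
      \<le> (c (X \<union> Y) + c (insert x (X \<union> Y))) * (d (X \<inter> Y) + d (insert x (X \<inter> Y)))"
    if XY: "X \<subseteq> U" "Y \<subseteq> U" for X Y
  proof -
    have "x \<notin> X" "x \<notin> Y" using XY insert.hyps by auto
    then have ins: "X \<inter> insert x Y = X \<inter> Y" "insert x X \<inter> Y = X \<inter> Y"
      by auto
    have sub: "X \<subseteq> insert x U" "insert x X \<subseteq> insert x U" "Y \<subseteq> insert x U"
      "insert x Y \<subseteq> insert x U" using XY by auto
    show ?thesis
      using insert.prems(5)[OF sub(1) sub(3)] insert.prems(5)[OF sub(1) sub(4)]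
        insert.prems(5)[OF sub(2) sub(3)] insert.prems(5)[OF sub(2) sub(4)] insert.prems(1-4)
      by (intro four_functions_one_point) (simp_all add: ins)
  qed
  then have "(\<Sum>X\<in>Pow U. a X + a (insert x X)) * (\<Sum>X\<in>Pow U. b X + b (insert x X))
      \<le> (\<Sum>X\<in>Pow U. c X + c (insert x X)) * (\<Sum>X\<in>Pow U. d X + d (insert x X))"
    by (intro insert.IH) (use insert.prems(1-4) in \<open>auto intro: add_nonneg_nonneg\<close>)
  then show ?case
    using insert.hyps by (simp add: sum_Pow_insert)
qed

corollary daykin_inequality:
  assumes "finite U" "A \<subseteq> Pow U" "B \<subseteq> Pow U" "C \<subseteq> Pow U" "D \<subseteq> Pow U"
    and C: "\<And>X Y. X \<in> A \<Longrightarrow> Y \<in> B \<Longrightarrow> X \<union> Y \<in> C"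
    and D: "\<And>X Y. X \<in> A \<Longrightarrow> Y \<in> B \<Longrightarrow> X \<inter> Y \<in> D"
  shows "card A * card B \<le> card C * card D"
proof -
  let ?ind = "\<lambda>F X. of_bool (X \<in> F) :: real"
  have card_eq: "sum (?ind F) (Pow U) = real (card F)" if "F \<subseteq> Pow U" for F
    using that \<open>finite U\<close> by (simp add: of_bool_def sum.If_cases Int_absorb1)
  have "sum (?ind A) (Pow U) * sum (?ind B) (Pow U) \<le> sum (?ind C) (Pow U) * sum (?ind D) (Pow U)"
    using C D by (intro four_functions[OF \<open>finite U\<close>]) auto
  then show ?thesis
    using assms(2-5) by (simp add: card_eq flip: of_nat_mult)
qed

section \<open>The lattice of tableaux\<close>

definition marked_min :: "int \<Rightarrow> int \<Rightarrow> int" where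
  "marked_min a b = (if marked_le a b then a else b)"

definition marked_max :: "int \<Rightarrow> int \<Rightarrow> int" where
  "marked_max a b = (if marked_le a b then b else a)"

lemma marked_le_marked_min_iff:
  "marked_le x (marked_min a b) \<longleftrightarrow> marked_le x a \<and> marked_le x b"
  by (auto simp: marked_min_def marked_le_def)

lemma marked_le_marked_max_iff:
  "marked_le x (marked_max a b) \<longleftrightarrow> marked_le x a \<or> marked_le x b"
  by (auto simp: marked_max_def marked_le_def)

lemma marked_le_refl: "marked_le a a"
  by (simp add: marked_le_def)

lemma marked_le_antisym: "marked_le a b \<Longrightarrow> marked_le b a \<Longrightarrow> a = b"
  by (auto simp: marked_le_def)

lemma marked_le_trans: "marked_le a b \<Longrightarrow> marked_le b c \<Longrightarrow> marked_le a c"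
  by (auto simp: marked_le_def)

lemma abs_marked_min: "\<bar>marked_min a b\<bar> = min \<bar>a\<bar> \<bar>b\<bar>"
  by (auto simp: marked_min_def marked_le_def)

lemma abs_marked_max: "\<bar>marked_max a b\<bar> = max \<bar>a\<bar> \<bar>b\<bar>"
  by (auto simp: marked_max_def marked_le_def)

text \<open>
  These are the relations that (T1) and (T2) together impose on the entries of two cells in one row
  and of two cells in one column.
\<close>

definition row_le :: "int \<Rightarrow> int \<Rightarrow> bool" where
  "row_le a b \<longleftrightarrow> marked_le a b \<and> (a = b \<longrightarrow> 0 < a)"

definition col_le :: "int \<Rightarrow> int \<Rightarrow> bool" where
  "col_le a b \<longleftrightarrow> marked_le a b \<and> (a = b \<longrightarrow> a < 0)"

text \<open>
  This absorption of \<open>marked_le\<close> on both sides gives closure under minimum and maximum: if the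
  minimum of two right-hand entries is \<open>b\<close>, compare it with its own left neighbour, which lies above
  the minimum of the left-hand entries; dually for the maximum.
\<close>

lemma row_le_mono: "marked_le a' a \<Longrightarrow> row_le a b \<Longrightarrow> marked_le b b' \<Longrightarrow> row_le a' b'"
  unfolding row_le_def by (metis marked_le_antisym marked_le_trans)

lemma col_le_mono: "marked_le a' a \<Longrightarrow> col_le a b \<Longrightarrow> marked_le b b' \<Longrightarrow> col_le a' b'"
  unfolding col_le_def by (metis marked_le_antisym marked_le_trans)

lemma row_le_marked_min:
  "row_le a b \<Longrightarrow> row_le a' b' \<Longrightarrow> row_le (marked_min a a') (marked_min b b')"
  by (metis marked_min_def row_le_mono marked_le_marked_min_iff marked_le_refl)

lemma row_le_marked_max:
  "row_le a b \<Longrightarrow> row_le a' b' \<Longrightarrow> row_le (marked_max a a') (marked_max b b')"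
  by (metis marked_max_def row_le_mono marked_le_marked_max_iff marked_le_refl)

lemma col_le_marked_min:
  "col_le a b \<Longrightarrow> col_le a' b' \<Longrightarrow> col_le (marked_min a a') (marked_min b b')"
  by (metis marked_min_def col_le_mono marked_le_marked_min_iff marked_le_refl)

lemma col_le_marked_max:
  "col_le a b \<Longrightarrow> col_le a' b' \<Longrightarrow> col_le (marked_max a a') (marked_max b b')"
  by (metis marked_max_def col_le_mono marked_le_marked_max_iff marked_le_refl)

text \<open>
  The uniqueness clauses of (T2) become conditions on pairs of cells, so that a tableau is a filling
  with two-variable constraints only. This is the form in which closure under minimum and maximum can
  be checked letter by letter.
\<close>

lemma shifted_ssyt_iff:
  "T \<in> shifted_ssyt lam \<longleftrightarrow>
     T \<in> shifted_diagram lam \<rightarrow>\<^sub>E - {0} \<and>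
     (\<forall>i j j'. (i, j) \<in> shifted_diagram lam \<and> (i, j') \<in> shifted_diagram lam \<and> j < j'
        \<longrightarrow> row_le (T (i, j)) (T (i, j'))) \<and>
     (\<forall>i i' j. (i, j) \<in> shifted_diagram lam \<and> (i', j) \<in> shifted_diagram lam \<and> i < i'
        \<longrightarrow> col_le (T (i, j)) (T (i', j)))" (is "_ \<longleftrightarrow> ?fill \<and> ?rows \<and> ?cols")
proof
  assume T: "T \<in> shifted_ssyt lam"
  then have fill: ?fill
    and row: "\<And>i j j'. (i, j) \<in> shifted_diagram lam \<Longrightarrow> (i, j') \<in> shifted_diagram lam \<Longrightarrow> j \<le> j'
        \<Longrightarrow> marked_le (T (i, j)) (T (i, j'))"
    and col: "\<And>i i' j. (i, j) \<in> shifted_diagram lam \<Longrightarrow> (i', j) \<in> shifted_diagram lam \<Longrightarrow> i \<le> i'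
        \<Longrightarrow> marked_le (T (i, j)) (T (i', j))"
    and bar: "\<And>m i. 0 < m \<Longrightarrow> \<exists>\<^sub>\<le>\<^sub>1 j. (i, j) \<in> shifted_diagram lam \<and> T (i, j) = - m"
    and unbar: "\<And>m j. 0 < m \<Longrightarrow> \<exists>\<^sub>\<le>\<^sub>1 i. (i, j) \<in> shifted_diagram lam \<and> T (i, j) = m"
    unfolding shifted_ssyt_def by blast+
  have nz: "T c \<noteq> 0" if "c \<in> shifted_diagram lam" for c
    using fill that by (auto simp: PiE_iff)
  have ?rows
  proof (intro allI impI, elim conjE)
    fix i j j' assume c: "(i, j) \<in> shifted_diagram lam" "(i, j') \<in> shifted_diagram lam" "j < j'"
    have "0 < T (i, j)" if eq: "T (i, j) = T (i, j')"
    proof (rule ccontr)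
      assume "\<not> 0 < T (i, j)"
      then have "0 < - T (i, j)" using nz[OF c(1)] by simp
      from bar[OF this, of i] eq c show False by (auto simp: Uniq_def)
    qed
    then show "row_le (T (i, j)) (T (i, j'))" using row c by (simp add: row_le_def)
  qed
  moreover have ?cols
  proof (intro allI impI, elim conjE)
    fix i i' j assume c: "(i, j) \<in> shifted_diagram lam" "(i', j) \<in> shifted_diagram lam" "i < i'"
    have "T (i, j) < 0" if eq: "T (i, j) = T (i', j)"
    proof (rule ccontr)
      assume "\<not> T (i, j) < 0"
      then have "0 < T (i, j)" using nz[OF c(1)] by simp
      from unbar[OF this, of j] eq c show False by (auto simp: Uniq_def)
    qed
    then show "col_le (T (i, j)) (T (i', j))" using col c by (simp add: col_le_def)
  qed
  ultimately show "?fill \<and> ?rows \<and> ?cols" using fill by blast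
next
  assume R: "?fill \<and> ?rows \<and> ?cols"
  then have row: "\<And>i j j'. (i, j) \<in> shifted_diagram lam \<Longrightarrow> (i, j') \<in> shifted_diagram lam \<Longrightarrow> j < j'
        \<Longrightarrow> row_le (T (i, j)) (T (i, j'))"
    and col: "\<And>i i' j. (i, j) \<in> shifted_diagram lam \<Longrightarrow> (i', j) \<in> shifted_diagram lam \<Longrightarrow> i < i'
        \<Longrightarrow> col_le (T (i, j)) (T (i', j))"
    by blast+
  have bar: "j = j'" if "0 < m" "(i, j) \<in> shifted_diagram lam" "T (i, j) = - m"
      "(i, j') \<in> shifted_diagram lam" "T (i, j') = - m" for m i j j'
    using row[of i j j'] row[of i j' j] that
    by (cases j j' rule: linorder_cases) (auto simp: row_le_def)
  have unbar: "i = i'" if "0 < m" "(i, j) \<in> shifted_diagram lam" "T (i, j) = m"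
      "(i', j) \<in> shifted_diagram lam" "T (i', j) = m" for m i i' j
    using col[of i j i'] col[of i' j i] that
    by (cases i i' rule: linorder_cases) (auto simp: col_le_def)
  have row': "marked_le (T (i, j)) (T (i, j'))"
    if "(i, j) \<in> shifted_diagram lam" "(i, j') \<in> shifted_diagram lam" "j \<le> j'" for i j j'
    using row[of i j j'] that by (cases "j = j'") (auto simp: row_le_def marked_le_refl)
  have col': "marked_le (T (i, j)) (T (i', j))"
    if "(i, j) \<in> shifted_diagram lam" "(i', j) \<in> shifted_diagram lam" "i \<le> i'" for i i' j
    using col[of i j i'] that by (cases "i = i'") (auto simp: col_le_def marked_le_refl)
  have ?fill using R by blast
  then show "T \<in> shifted_ssyt lam"
    unfolding shifted_ssyt_def Uniq_def
    by (intro CollectI conjI allI impI; (elim conjE)?)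
      (assumption | erule (2) row' | erule (2) col' | erule (4) bar | erule (4) unbar)+
qed

lemma shifted_ssyt_closed:
  assumes T: "T \<in> shifted_ssyt lam" and S: "S \<in> shifted_ssyt lam"
  shows shifted_ssyt_marked_min: "(\<lambda>c. marked_min (T c) (S c)) \<in> shifted_ssyt lam"
    and shifted_ssyt_marked_max: "(\<lambda>c. marked_max (T c) (S c)) \<in> shifted_ssyt lam"
proof -
  \<comment> \<open>Off the diagram both fillings are \<open>undefined\<close>, and so are their minimum and maximum.\<close>
  have "(\<lambda>c. marked_min (T c) (S c)) \<in> shifted_diagram lam \<rightarrow>\<^sub>E - {0}"
    "(\<lambda>c. marked_max (T c) (S c)) \<in> shifted_diagram lam \<rightarrow>\<^sub>E - {0}"
    using T S unfolding shifted_ssyt_iff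
    by (auto simp: PiE_iff extensional_def marked_min_def marked_max_def)
  with T S show "(\<lambda>c. marked_min (T c) (S c)) \<in> shifted_ssyt lam"
    "(\<lambda>c. marked_max (T c) (S c)) \<in> shifted_ssyt lam"
    unfolding shifted_ssyt_iff
    by (simp_all add: row_le_marked_min row_le_marked_max col_le_marked_min col_le_marked_max)
qed

section \<open>Tableaux with entries in a window\<close>

definition window_ssyt :: "nat list \<Rightarrow> int \<Rightarrow> int \<Rightarrow> (nat \<times> nat \<Rightarrow> int) set" where
  "window_ssyt lam l u =
     {T \<in> shifted_ssyt lam. \<forall>c \<in> shifted_diagram lam. l \<le> \<bar>T c\<bar> \<and> \<bar>T c\<bar> \<le> u}"

lemma finite_shifted_diagram: "finite (shifted_diagram lam)"
proof -
  have "shifted_diagram lam = (SIGMA i:{..<length lam}. {i..<i + lam ! i})"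
    by (auto simp: shifted_diagram_def)
  then show ?thesis by simp
qed

lemma finite_window_ssyt: "finite (window_ssyt lam l u)"
proof (rule finite_subset)
  show "window_ssyt lam l u \<subseteq> shifted_diagram lam \<rightarrow>\<^sub>E {-u..u}"
    by (force simp: window_ssyt_def shifted_ssyt_iff PiE_iff abs_le_iff)
  show "finite (shifted_diagram lam \<rightarrow>\<^sub>E {-u..u})"
    by (intro finite_PiE finite_shifted_diagram) simp
qed

lemma schurQ_ones: "schurQ lam (ones n) = real (card (window_ssyt lam 1 (int n)))"
proof -
  have ones: "(\<Prod>c \<in> shifted_diagram lam. ones n (nat \<bar>T c\<bar>)) =
      of_bool (\<forall>c \<in> shifted_diagram lam. 1 \<le> \<bar>T c\<bar> \<and> \<bar>T c\<bar> \<le> int n)" for T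
  proof (cases "\<forall>c \<in> shifted_diagram lam. 1 \<le> \<bar>T c\<bar> \<and> \<bar>T c\<bar> \<le> int n")
    case True
    then have "ones n (nat \<bar>T c\<bar>) = 1" if "c \<in> shifted_diagram lam" for c
      using that by (auto simp: ones_def le_nat_iff nat_le_iff)
    with True show ?thesis by simp
  next
    case False
    then obtain c where "c \<in> shifted_diagram lam" "\<not> (1 \<le> \<bar>T c\<bar> \<and> \<bar>T c\<bar> \<le> int n)" by blast
    then have "\<exists>c \<in> shifted_diagram lam. ones n (nat \<bar>T c\<bar>) = 0"
      by (intro bexI[of _ c]) (auto simp: ones_def)
    then have "(\<Prod>c \<in> shifted_diagram lam. ones n (nat \<bar>T c\<bar>)) = 0"
      by (intro prod_zero finite_shifted_diagram)
    with False show ?thesis by auto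
  qed
  have "schurQ lam (ones n) = (\<Sum>\<^sub>\<infinity>T \<in> window_ssyt lam 1 (int n). 1)"
    unfolding schurQ_def ones by (rule infsum_cong_neutral) (auto simp: window_ssyt_def)
  then show ?thesis by (simp add: finite_window_ssyt)
qed

lemma relabel_shifted_ssyt:
  assumes T: "T \<in> shifted_ssyt lam"
    and nz: "\<And>c. c \<in> shifted_diagram lam \<Longrightarrow> f (T c) \<noteq> 0"
    and row: "\<And>c c'. c \<in> shifted_diagram lam \<Longrightarrow> c' \<in> shifted_diagram lam \<Longrightarrow>
      row_le (T c) (T c') \<Longrightarrow> row_le (f (T c)) (f (T c'))"
    and col: "\<And>c c'. c \<in> shifted_diagram lam \<Longrightarrow> c' \<in> shifted_diagram lam \<Longrightarrow>
      col_le (T c) (T c') \<Longrightarrow> col_le (f (T c)) (f (T c'))"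
  shows "restrict (\<lambda>c. f (T c)) (shifted_diagram lam) \<in> shifted_ssyt lam"
  using T nz unfolding shifted_ssyt_iff by (auto intro!: row col)

lemma abs_raise: "a \<noteq> 0 \<Longrightarrow> \<bar>a + sgn a\<bar> = \<bar>a\<bar> + 1" for a :: int
  by (auto simp: sgn_if)

lemma raise_eq_0_iff: "a + sgn a = 0 \<longleftrightarrow> a = 0" for a :: int
  by (auto simp: sgn_if)

lemma row_le_raise_iff:
  assumes "a \<noteq> 0" "b \<noteq> 0"
  shows "row_le (a + sgn a) (b + sgn b) \<longleftrightarrow> row_le a b"
  using assms by (cases "0 < a"; cases "0 < b") (auto simp: row_le_def marked_le_def)

lemma col_le_raise_iff:
  assumes "a \<noteq> 0" "b \<noteq> 0"
  shows "col_le (a + sgn a) (b + sgn b) \<longleftrightarrow> col_le a b"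
  using assms by (cases "0 < a"; cases "0 < b") (auto simp: col_le_def marked_le_def)

text \<open>
  Raising every absolute value by one keeps signs and is inverted by lowering every absolute value by
  one, which preserves the tableau conditions as long as the letters \<open>-1\<close> and \<open>1\<close> do not occur.
\<close>

lemma card_window_ssyt_shift:
  "card (window_ssyt lam 2 (u + 1)) = card (window_ssyt lam 1 u)"
proof -
  let ?D = "shifted_diagram lam"
  define up where "up T = restrict (\<lambda>c. T c + sgn (T c)) ?D" for T :: "nat \<times> nat \<Rightarrow> int"
  define down where "down T = restrict (\<lambda>c. T c - sgn (T c)) ?D" for T :: "nat \<times> nat \<Rightarrow> int"
  have ext: "T \<in> extensional ?D" if "T \<in> window_ssyt lam l u'" for T l u'
    using that by (auto simp: window_ssyt_def shifted_ssyt_iff PiE_iff)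
  have low: "l \<le> \<bar>T c\<bar>" if "T \<in> window_ssyt lam l u'" "c \<in> ?D" for T l u' c
    using that by (auto simp: window_ssyt_def)
  have "up T \<in> window_ssyt lam 2 (u + 1)" if T: "T \<in> window_ssyt lam 1 u" for T
  proof -
    have nz: "T c \<noteq> 0" if "c \<in> ?D" for c
      using low[OF T that] by auto
    have "up T \<in> shifted_ssyt lam"
      unfolding up_def
      by (rule relabel_shifted_ssyt[where f = "\<lambda>x. x + sgn x"])
        (use T nz in \<open>auto simp: window_ssyt_def row_le_raise_iff col_le_raise_iff raise_eq_0_iff\<close>)
    with T nz show ?thesis
      by (auto simp: window_ssyt_def up_def abs_raise)
  qed
  moreover have "down T \<in> window_ssyt lam 1 u" if T: "T \<in> window_ssyt lam 2 (u + 1)" for T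
  proof -
    have nz: "T c - sgn (T c) \<noteq> 0" and raise: "T c - sgn (T c) + sgn (T c - sgn (T c)) = T c"
      if "c \<in> ?D" for c
      using low[OF T that] by (auto simp: sgn_if)
    have "down T \<in> shifted_ssyt lam"
      unfolding down_def
    proof (rule relabel_shifted_ssyt[where f = "\<lambda>x. x - sgn x"])
      show "T \<in> shifted_ssyt lam" using T by (simp add: window_ssyt_def)
    next
      fix c c' assume c: "c \<in> ?D" "c' \<in> ?D"
      show "row_le (T c - sgn (T c)) (T c' - sgn (T c'))" if "row_le (T c) (T c')"
        using row_le_raise_iff[OF nz nz, OF c] that raise[OF c(1)] raise[OF c(2)] by simp
      show "col_le (T c - sgn (T c)) (T c' - sgn (T c'))" if "col_le (T c) (T c')"
        using col_le_raise_iff[OF nz nz, OF c] that raise[OF c(1)] raise[OF c(2)] by simp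
    qed (rule nz)
    moreover have "1 \<le> \<bar>down T c\<bar> \<and> \<bar>down T c\<bar> \<le> u" if c: "c \<in> ?D" for c
    proof -
      have "\<bar>T c\<bar> = \<bar>T c - sgn (T c)\<bar> + 1"
        using abs_raise[OF nz[OF c]] raise[OF c] by simp
      with T c show ?thesis by (auto simp: window_ssyt_def down_def)
    qed
    ultimately show ?thesis by (simp add: window_ssyt_def)
  qed
  moreover have "down (up T) = T" if T: "T \<in> window_ssyt lam 1 u" for T
    using ext[OF T] by (intro extensionalityI[of _ ?D]) (auto simp: up_def down_def sgn_if)
  moreover have "up (down T) = T" if T: "T \<in> window_ssyt lam 2 (u + 1)" for T
  proof (rule extensionalityI[of _ ?D])
    fix c assume c: "c \<in> ?D"
    then show "up (down T) c = T c"
      using low[OF T c] by (auto simp: up_def down_def sgn_if)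
  qed (use ext[OF T] in \<open>auto simp: up_def\<close>)
  ultimately have "bij_betw down (window_ssyt lam 2 (u + 1)) (window_ssyt lam 1 u)"
    by (intro bij_betw_byWitness[where f' = up]) auto
  then show ?thesis by (rule bij_betw_same_card)
qed

section \<open>Log-concavity\<close>

text \<open>
  This set determines the tableau because every letter is determined by the letters below it. The
  letter 0 lies below all others, hence occurs at every cell, harmlessly.
\<close>

definition down_set :: "nat list \<Rightarrow> (nat \<times> nat \<Rightarrow> int) \<Rightarrow> ((nat \<times> nat) \<times> int) set" where
  "down_set lam T = (SIGMA c : shifted_diagram lam. {x. marked_le x (T c)})"

lemma down_set_marked_min:
  "down_set lam (\<lambda>c. marked_min (T c) (S c)) = down_set lam T \<inter> down_set lam S"
  by (auto simp: down_set_def marked_le_marked_min_iff)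

lemma down_set_marked_max:
  "down_set lam (\<lambda>c. marked_max (T c) (S c)) = down_set lam T \<union> down_set lam S"
  by (auto simp: down_set_def marked_le_marked_max_iff)

lemma inj_on_down_set: "inj_on (down_set lam) (shifted_ssyt lam)"
proof (rule inj_onI)
  fix T S assume "T \<in> shifted_ssyt lam" "S \<in> shifted_ssyt lam"
    and eq: "down_set lam T = down_set lam S"
  then have "T \<in> extensional (shifted_diagram lam)" "S \<in> extensional (shifted_diagram lam)"
    by (auto simp: shifted_ssyt_iff PiE_iff)
  then show "T = S"
  proof (rule extensionalityI)
    fix c assume c: "c \<in> shifted_diagram lam"
    have iff: "marked_le x (T c) \<longleftrightarrow> marked_le x (S c)" for x
      using eq c by (auto simp: down_set_def)
    show "T c = S c"
      using iff[of "T c"] iff[of "S c"] by (simp add: marked_le_refl marked_le_antisym)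
  qed
qed

text \<open>
  For \<open>T\<close> in the first window and \<open>S\<close> in the second, the maximum inherits the larger lower bound and
  the minimum the smaller upper bound. With the windows \<open>{1..n+1}\<close> and \<open>{2..n}\<close> the two windows on
  the right-hand side have the same length.
\<close>

lemma window_ssyt_log_concave:
  assumes "l \<le> l'" "u' \<le> u"
  shows "card (window_ssyt lam l u) * card (window_ssyt lam l' u')
       \<le> card (window_ssyt lam l' u) * card (window_ssyt lam l u')"
proof -
  let ?F = "\<lambda>a b. down_set lam ` window_ssyt lam a b"
  let ?U = "shifted_diagram lam \<times> {-u..u}"
  have sub: "?F a b \<subseteq> Pow ?U" if "b \<le> u" for a b
    using that by (force simp: down_set_def window_ssyt_def marked_le_def abs_le_iff)
  have card_F: "card (?F a b) = card (window_ssyt lam a b)" for a b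
    by (intro card_image inj_on_subset[OF inj_on_down_set]) (auto simp: window_ssyt_def)
  have "card (?F l u) * card (?F l' u') \<le> card (?F l' u) * card (?F l u')"
  proof (rule daykin_inequality[of ?U])
    fix X Y assume "X \<in> ?F l u" "Y \<in> ?F l' u'"
    then obtain T S where T: "T \<in> window_ssyt lam l u" "X = down_set lam T"
      and S: "S \<in> window_ssyt lam l' u'" "Y = down_set lam S" by blast
    have "(\<lambda>c. marked_max (T c) (S c)) \<in> window_ssyt lam l' u"
      using T(1) S(1) assms
      by (force simp: window_ssyt_def shifted_ssyt_marked_max abs_marked_max)
    then show "X \<union> Y \<in> ?F l' u"
      unfolding T S down_set_marked_max[symmetric] by (rule imageI)
    have "(\<lambda>c. marked_min (T c) (S c)) \<in> window_ssyt lam l u'"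
      using T(1) S(1) assms
      by (force simp: window_ssyt_def shifted_ssyt_marked_min abs_marked_min)
    then show "X \<inter> Y \<in> ?F l u'"
      unfolding T S down_set_marked_min[symmetric] by (rule imageI)
  qed (use assms sub in \<open>simp_all add: finite_shifted_diagram\<close>)
  then show ?thesis by (simp only: card_F)
qed

theorem corollary4p6:
  fixes lam :: "nat list"
  assumes "strict_partition lam"
  shows "\<forall>n\<ge>1. (schurQ lam (ones n))\<^sup>2
                 \<ge> schurQ lam (ones (n - 1)) * schurQ lam (ones (n + 1))"
proof (intro allI impI)
  fix n :: nat assume n: "n \<ge> 1"
  let ?q = "\<lambda>k. card (window_ssyt lam 1 (int k))"
  have "?q (n + 1) * card (window_ssyt lam 2 (int n))
      \<le> card (window_ssyt lam 2 (int n + 1)) * ?q n"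
    using window_ssyt_log_concave[of 1 2 "int n" "int n + 1" lam] by (simp add: add.commute)
  moreover have "card (window_ssyt lam 2 (int n)) = ?q (n - 1)"
    using card_window_ssyt_shift[of lam "int (n - 1)"] n by simp
  moreover have "card (window_ssyt lam 2 (int n + 1)) = ?q n"
    by (rule card_window_ssyt_shift)
  ultimately have "?q (n - 1) * ?q (n + 1) \<le> (?q n)\<^sup>2"
    by (simp add: power2_eq_square mult.commute)
  then have "real (?q (n - 1) * ?q (n + 1)) \<le> real ((?q n)\<^sup>2)"
    by (simp only: of_nat_le_iff)
  then show "schurQ lam (ones (n - 1)) * schurQ lam (ones (n + 1)) \<le> (schurQ lam (ones n))\<^sup>2"
    by (simp only: schurQ_ones of_nat_mult of_nat_power)
qed

end
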